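(* Let $\varphi\in\mathcal{L}(I)$ be arbitrary. Then, under the standard (single-relation) semantics, $$\vDash I^R\varphi\leftrightarrow I\varphi\land\bigl(I I\varphi\vee I(\varphi\to I\varphi)\bigr),$$ i.e. this formula is valid on the class of all frames.
   Context: Language. Fix a nonempty set $\mathbf{P}$ of propositional variables. The formulas of the language $\mathbf{IRI}$ are given by $\varphi::=p\mid\neg\varphi\mid(\varphi\land\varphi)\mid I\varphi\mid I^R\varphi$ with $p\in\mathbf{P}$; other Boolean connectives are defined as usual. $\mathcal{L}(I)$ is the fragment of $\mathbf{IRI}$ without the construct $I^R\varphi$. Standard semantics. A frame is a pair $\langle S,R\rangle$ with $S$ a nonempty set and $R$ a binary relation on $S$; a model $\mathcal{M}=\langle S,R,V\rangle$ is a frame with a valuation $V:\mathbf{P}\to\mathcal{P}(S)$. Truth at $s\in S$: $\mathcal{M},s\vDash p$ iff $s\in V(p)$; $\neg,\land$ are interpreted classically; $\mathcal{M},s\vDash I\varphi$ iff there is $t$ with $sRt$ and $\mathcal{M},t\vDash\varphi$, and there is $u$ with $sRu$ and $\mathcal{M},u\nvDash\varphi$; $\mathcal{M},s\vDash I^R\varphi$ iff $\mathcal{M},s\vDash I\varphi$ and there is $t$ with $sRt$ and $\mathcal{M},t\nvDash I\varphi$. $\vDash\varphi$ means that $\varphi$ is true at every state of every model. *)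

theory Defs
  imports Main
begin

text \<open>The propositional variables are the elements of an arbitrary type \<open>'p\<close>
  (nonempty, as every HOL type is).\<close>

datatype 'p form =
    Var 'p
  | Neg "'p form"
  | Conj "'p form" "'p form"
  | Ign "'p form"   \<comment> \<open>\<open>I \<phi>\<close>\<close>
  | RIgn "'p form"  \<comment> \<open>\<open>I\<^sup>R \<phi>\<close>\<close>

definition Disj :: "'p form \<Rightarrow> 'p form \<Rightarrow> 'p form" where
  "Disj \<phi> \<psi> = Neg (Conj (Neg \<phi>) (Neg \<psi>))"

definition Imp :: "'p form \<Rightarrow> 'p form \<Rightarrow> 'p form" where
  "Imp \<phi> \<psi> = Neg (Conj \<phi> (Neg \<psi>))"

definition Iff :: "'p form \<Rightarrow> 'p form \<Rightarrow> 'p form" where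
  "Iff \<phi> \<psi> = Conj (Imp \<phi> \<psi>) (Imp \<psi> \<phi>)"

text \<open>The fragment \<open>\<L>(I)\<close>: formulas in which \<open>I\<^sup>R\<close> does not occur.\<close>

inductive_set LI :: "'p form set" where
  Var: "Var p \<in> LI"
| Neg: "\<phi> \<in> LI \<Longrightarrow> Neg \<phi> \<in> LI"
| Conj: "\<phi> \<in> LI \<Longrightarrow> \<psi> \<in> LI \<Longrightarrow> Conj \<phi> \<psi> \<in> LI"
| Ign: "\<phi> \<in> LI \<Longrightarrow> Ign \<phi> \<in> LI"

record 's frame =
  states :: "'s set"
  rel :: "('s \<times> 's) set"

record ('s, 'p) model = "'s frame" +
  val :: "'p \<Rightarrow> 's set"

definition is_frame :: "('s, 'z) frame_scheme \<Rightarrow> bool" where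
  "is_frame F \<longleftrightarrow> states F \<noteq> {} \<and> rel F \<subseteq> states F \<times> states F"

definition is_model :: "('s, 'p) model \<Rightarrow> bool" where
  "is_model M \<longleftrightarrow> is_frame M \<and> (\<forall>p. val M p \<subseteq> states M)"

text \<open>Successors of a state need not be required to lie in \<open>states M\<close>, since
  \<open>is_model\<close> makes \<open>rel M\<close> a relation on \<open>states M\<close>. The clause for \<open>RIgn\<close> spells
  out the truth condition of \<open>Ign \<phi>\<close>, at \<open>s\<close> and at \<open>t\<close>, so that the recursion is
  primitive; see \<open>sat_RIgn\<close>.\<close>

primrec sat :: "('s, 'p) model \<Rightarrow> 's \<Rightarrow> 'p form \<Rightarrow> bool" where
  "sat M s (Var p) \<longleftrightarrow> s \<in> val M p"
| "sat M s (Neg \<phi>) \<longleftrightarrow> \<not> sat M s \<phi>"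
| "sat M s (Conj \<phi> \<psi>) \<longleftrightarrow> sat M s \<phi> \<and> sat M s \<psi>"
| "sat M s (Ign \<phi>) \<longleftrightarrow>
     (\<exists>t. (s, t) \<in> rel M \<and> sat M t \<phi>) \<and> (\<exists>u. (s, u) \<in> rel M \<and> \<not> sat M u \<phi>)"
| "sat M s (RIgn \<phi>) \<longleftrightarrow>
     ((\<exists>t. (s, t) \<in> rel M \<and> sat M t \<phi>) \<and> (\<exists>u. (s, u) \<in> rel M \<and> \<not> sat M u \<phi>)) \<and>
     (\<exists>t. (s, t) \<in> rel M \<and>
       \<not> ((\<exists>v. (t, v) \<in> rel M \<and> sat M v \<phi>) \<and> (\<exists>u. (t, u) \<in> rel M \<and> \<not> sat M u \<phi>)))"

lemma sat_RIgn:
  "sat M s (RIgn \<phi>) \<longleftrightarrow>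
     sat M s (Ign \<phi>) \<and> (\<exists>t. (s, t) \<in> rel M \<and> \<not> sat M t (Ign \<phi>))"
  by simp

text \<open>A definition in HOL cannot quantify over types, so validity takes the type of
  states as a parameter. Validity over all models is validity for an arbitrary \<open>'s\<close>.\<close>

definition valid :: "'s itself \<Rightarrow> 'p form \<Rightarrow> bool" where
  "valid _ \<phi> \<longleftrightarrow> (\<forall>M :: ('s, 'p) model. is_model M \<longrightarrow> (\<forall>s \<in> states M. sat M s \<phi>))"

end

theory Submission
  imports Defs
begin

text \<open>Given \<open>Ign \<phi>\<close> at a state, \<open>RIgn \<phi>\<close> adds just a
  successor refuting \<open>Ign \<phi>\<close>. If another successor satisfies
  \<open>Ign \<phi>\<close>, that is the first disjunct. If none does,
  \<open>Imp \<phi> (Ign \<phi>)\<close> amounts to \<open>Neg \<phi>\<close> on all successors, and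
  ignorance of \<phi> is ignorance of its negation, which gives the second. Conversely, each
  disjunct supplies such a successor. \<open>sat_RIgn_iff\<close> is this argument at a single
  state.\<close>

lemma sat_RIgn_iff:
  "sat M s (RIgn \<phi>) \<longleftrightarrow>
     sat M s (Conj (Ign \<phi>) (Disj (Ign (Ign \<phi>)) (Ign (Imp \<phi> (Ign \<phi>)))))"
  (is "?L \<longleftrightarrow> ?R")
proof
  assume L: ?L
  then have ign: "sat M s (Ign \<phi>)"
    and not_ign: "\<exists>t. (s, t) \<in> rel M \<and> \<not> sat M t (Ign \<phi>)"
    unfolding sat_RIgn by blast+
  show ?R
  proof (cases "\<exists>t. (s, t) \<in> rel M \<and> sat M t (Ign \<phi>)")
    case True
    with not_ign have "sat M s (Ign (Ign \<phi>))"
      unfolding sat.simps(4)[of M s "Ign \<phi>"] by blast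
    with ign show ?thesis by (simp add: Disj_def del: sat.simps(4))
  next
    case False
    \<comment> \<open>Now \<open>\<phi> \<rightarrow> I \<phi>\<close> agrees with \<open>\<not> \<phi>\<close> on the successors of \<open>s\<close>.\<close>
    then have "sat M t (Imp \<phi> (Ign \<phi>)) \<longleftrightarrow> \<not> sat M t \<phi>" if "(s, t) \<in> rel M" for t
      using that by (auto simp: Imp_def simp del: sat.simps(4))
    \<comment> \<open>The two successors witnessing \<open>Ign \<phi>\<close> serve again with their
      roles swapped.\<close>
    with ign have "sat M s (Ign (Imp \<phi> (Ign \<phi>)))"
      unfolding sat.simps(4)[of M s "Imp \<phi> (Ign \<phi>)"] sat.simps(4)[of M s \<phi>] by blast
    with ign show ?thesis by (simp add: Disj_def del: sat.simps(4))
  qed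
next
  assume R: ?R
  then have ign: "sat M s (Ign \<phi>)"
    and "sat M s (Ign (Ign \<phi>)) \<or> sat M s (Ign (Imp \<phi> (Ign \<phi>)))"
    by (simp_all add: Disj_def del: sat.simps(4))
  \<comment> \<open>Here t is the negative witness of whichever disjunct holds: an implication fails
    only where its consequent \<open>Ign \<phi>\<close> fails.\<close>
  then obtain t where "(s, t) \<in> rel M" "\<not> sat M t (Ign \<phi>)"
    unfolding sat.simps(4)[of M s "Ign \<phi>"] sat.simps(4)[of M s "Imp \<phi> (Ign \<phi>)"]
    by (auto simp: Imp_def simp del: sat.simps(4))
  with ign show ?L unfolding sat_RIgn by blast
qed

theorem proposition4:
  fixes \<phi> :: "'p form"
  assumes "\<phi> \<in> LI"
  shows "valid TYPE('s)
           (Iff (RIgn \<phi>)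
                (Conj (Ign \<phi>) (Disj (Ign (Ign \<phi>)) (Ign (Imp \<phi> (Ign \<phi>))))))"
proof -
  have sat_Iff: "sat M s (Iff \<alpha> \<beta>) \<longleftrightarrow> (sat M s \<alpha> \<longleftrightarrow> sat M s \<beta>)"
    for M :: "('s, 'p) model" and s \<alpha> \<beta>
    by (auto simp: Iff_def Imp_def)
  show ?thesis
    unfolding valid_def sat_Iff by (intro allI impI ballI sat_RIgn_iff)
qed

end
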